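(* Let $H$ be a real Hilbert space and let $A:H\to 2^H$ be a maximal monotone operator with $A^{-1}(\mathbf{0}) := \{x\in H : \mathbf{0}\in A(x)\}\neq\emptyset$. Let $\lambda>0$ and let $\theta,\delta\in\mathbb{R}$ satisfy $$0\le\theta<\tfrac13,\qquad \frac{3\theta-1}{3+4\theta}<\delta\le 0 .$$ Choose $x_{-1},x_0,y_0\in H$ arbitrarily, subject to the assumption $x_0=x_{-1}=x_{-2}$, and let $\{x_n\}$ and $\{y_n\}$ be generated, for $n=0,1,2,\dots$, by $$x_{n+1}=J_\lambda^A(y_n),\qquad y_{n+1}=x_{n+1}+\theta(x_{n+1}-x_n)+\delta(x_n-x_{n-1}).$$ Then for every $x^*\in A^{-1}(\mathbf{0})$ and every integer $n\ge 2$, $$\min_{0\le j\le n-2}\|x_{j+1}-y_j\|^2\;\le\; 3\,(1+\theta^2+\delta^2)\,\frac{1}{c_2}\,\frac{(1-\theta-\delta)\,\|x_0-x^*\|^2}{n-1},$$ where $c_2=1-3\theta-2|\delta|-2\theta|\delta|+2\theta\delta+\delta$.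
   Context: $H$ is a real Hilbert space with inner product $\langle\cdot,\cdot\rangle$ and induced norm $\|\cdot\|$. A set-valued operator $A:H\to 2^H$ is monotone if $\langle x-y,f-g\rangle\ge 0$ for all $x,y\in H$, $f\in A(x)$, $g\in A(y)$; it is maximal monotone if, in addition, its graph $\{(x,f)\in H\times H: f\in A(x)\}$ is not properly contained in the graph of any other monotone operator. For $\lambda>0$, the resolvent of a maximal monotone $A$ is the single-valued, everywhere defined map $J_\lambda^A=(I+\lambda A)^{-1}:H\to H$, i.e. $J_\lambda^A(x)$ is the unique $z\in H$ with $x\in z+\lambda A(z)$. The point $x_{-2}\in H$ is an auxiliary starting point that appears only in the assumption $x_0=x_{-1}=x_{-2}$; the recursion itself uses only $x_{-1}$, $x_0$ and $y_0$.
   Formalization: The starting point y_0 is not arbitrary but given by the update formula y_0 = x_0 + θ(x_0 − x_{-1}) + δ(x_{-1} − x_{-2}), so y_0 = x_0; for arbitrary y_0 the bound fails (e.g. H = ℝ, A = I, λ = 1, θ = δ = 0, x_0 = x* = 0, y_0 = 1, n = 2). *)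

theory Defs
  imports "HOL-Analysis.Analysis"
begin

definition operator_graph :: "('a \<Rightarrow> 'a set) \<Rightarrow> ('a \<times> 'a) set" where
  "operator_graph A = {(x, f). f \<in> A x}"

definition monotone_operator :: "('a::real_inner \<Rightarrow> 'a set) \<Rightarrow> bool" where
  "monotone_operator A \<longleftrightarrow> (\<forall>x y. \<forall>f\<in>A x. \<forall>g\<in>A y. inner (x - y) (f - g) \<ge> 0)"

definition maximal_monotone :: "('a::real_inner \<Rightarrow> 'a set) \<Rightarrow> bool" where
  "maximal_monotone A \<longleftrightarrow> monotone_operator A \<and>
     \<not> (\<exists>B. monotone_operator B \<and> operator_graph A \<subset> operator_graph B)"

definition operator_zeros :: "('a::zero \<Rightarrow> 'a set) \<Rightarrow> 'a set" where
  "operator_zeros A = {x. 0 \<in> A x}"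

(* The map (I + l A)^{-1}. The description denotes the intended point whenever A is maximal
   monotone on a Hilbert space and l > 0 (Minty's theorem); that fact is not built into the definition. *)
definition resolvent :: "real \<Rightarrow> ('a::real_vector \<Rightarrow> 'a set) \<Rightarrow> 'a \<Rightarrow> 'a" where
  "resolvent l A x = (THE z. \<exists>f\<in>A z. x = z + l *\<^sub>R f)"

end

(* Minty's theorem supplies the points selected by the resolvent. It is obtained by minimising
   F (x, u) + |x|^2 / 2 + |u|^2 / 2 over H x H, where F is the Fitzpatrick function of the operator:
   strong convexity makes minimising sequences Cauchy, and first-order optimality at the
   minimiser (x, u) says that (-u, -x) is monotonically related to the graph.

   Firm nonexpansiveness then gives |x_{k+1} - p|^2 <= |y_k - p|^2 - |x_{k+1} - y_k|^2 for every
   zero p. Expanding both terms on the right makes the energy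
   |x_k - p|^2 - theta |x_{k-1} - p|^2 - delta |x_{k-2} - p|^2 decrease up to multiples of the
   squared steps |x_{k+1} - x_k|^2, so these are summable, and the minimum of the residuals is
   bounded by their average. *)
theory Submission
  imports Defs
begin

section \<open>Minty's theorem\<close>

text \<open>\<open>C\<close> plays the role of the epigraph of a closed convex function that may be
  infinite in places. Adding half the squared norm makes it strongly convex, so completeness of the
  space takes the place of weak compactness.\<close>

lemma strongly_convex_minimiser:
  fixes C :: "('b::{real_inner, complete_space} \<times> real) set"
  assumes "closed C" and "convex C" and "C \<noteq> {}"
    and lower: "\<And>z t. (z, t) \<in> C \<Longrightarrow> B \<le> t + (norm z)\<^sup>2 / 2"
  obtains z t where "(z, t) \<in> C"
    and "\<And>w s. (w, s) \<in> C \<Longrightarrow> t + (norm z)\<^sup>2 / 2 \<le> s + (norm w)\<^sup>2 / 2"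
proof -
  define h :: "'b \<times> real \<Rightarrow> real" where "h = (\<lambda>q. snd q + (norm (fst q))\<^sup>2 / 2)"
  define m where "m = Inf (h ` C)"
  have bdd: "bdd_below (h ` C)"
    using lower by (intro bdd_belowI2[of _ B]) (auto simp: h_def)
  have m_le: "m \<le> h q" if "q \<in> C" for q
    unfolding m_def using that bdd by (intro cINF_lower)
  have "\<exists>q\<in>C. h q < m + inverse (real (Suc i))" for i
  proof (rule ccontr)
    assume "\<not> ?thesis"
    then have "\<And>q. q \<in> C \<Longrightarrow> m + inverse (real (Suc i)) \<le> h q"
      by force
    with \<open>C \<noteq> {}\<close> have "m + inverse (real (Suc i)) \<le> m"
      by (subst (2) m_def) (auto intro: cINF_greatest)
    then show False
      by (simp add: inverse_eq_divide)
  qed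
  then obtain q where q: "\<And>i. q i \<in> C" "\<And>i. h (q i) < m + inverse (real (Suc i))"
    by metis
  have "(\<lambda>i. h (q i)) \<longlonglongrightarrow> m"
  proof (rule tendsto_sandwich[where f = "\<lambda>_. m"])
    show "(\<lambda>i. m + inverse (real (Suc i))) \<longlonglongrightarrow> m"
      by (rule LIMSEQ_inverse_real_of_nat_add)
  qed (use q m_le in \<open>auto intro!: eventuallyI less_imp_le\<close>)
  \<comment> \<open>The midpoint of two near-minimisers lies in \<open>C\<close> and undercuts the
    average of their values by an eighth of the squared distance, yet cannot go below
    \<open>m\<close>.\<close>
  have gap: "(dist (fst (q i)) (fst (q j)))\<^sup>2 \<le> 4 * (inverse (real (Suc i)) + inverse (real (Suc j)))" for i j
  proof -
    define a b where "a = fst (q i)" and "b = fst (q j)"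
    have "(1/2) *\<^sub>R q i + (1/2) *\<^sub>R q j \<in> C"
      using \<open>convex C\<close> q by (intro convexD) auto
    then have "m \<le> h ((1/2) *\<^sub>R q i + (1/2) *\<^sub>R q j)"
      by (rule m_le)
    also have "\<dots> = h (q i) / 2 + h (q j) / 2 - (norm (a - b))\<^sup>2 / 8"
      unfolding h_def a_def b_def
      by (simp add: power2_norm_eq_inner inner_commute algebra_simps) (simp add: field_simps)
    finally show ?thesis
      using q(2)[of i] q(2)[of j] by (simp add: a_def b_def dist_norm)
  qed
  have "Cauchy (\<lambda>i. fst (q i))"
  proof (rule CauchyI')
    fix e :: real
    assume "0 < e"
    then obtain M where M: "inverse (real (Suc M)) < e\<^sup>2 / 8"
      using reals_Archimedean[of "e\<^sup>2 / 8"] by auto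
    have "dist (fst (q i)) (fst (q j)) < e" if "M \<le> i" "i < j" for i j
    proof -
      have "inverse (real (Suc i)) \<le> inverse (real (Suc M))"
        "inverse (real (Suc j)) \<le> inverse (real (Suc M))"
        using that by (auto intro!: le_imp_inverse_le)
      with gap[of i j] M have "(dist (fst (q i)) (fst (q j)))\<^sup>2 < e\<^sup>2"
        by argo
      from this \<open>0 < e\<close> show ?thesis
        by (rule power2_less_imp_less[OF _ less_imp_le])
    qed
    then show "\<exists>M. \<forall>i\<ge>M. \<forall>j>i. dist (fst (q i)) (fst (q j)) < e"
      by blast
  qed
  then obtain z where z: "(\<lambda>i. fst (q i)) \<longlonglongrightarrow> z"
    using Cauchy_convergent_iff convergent_def by blast
  \<comment> \<open>The values \<open>h (q i)\<close> and the norms both converge, which forces the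
    limit of the second components.\<close>
  define t where "t = m - (norm z)\<^sup>2 / 2"
  have "(\<lambda>i. h (q i) - (norm (fst (q i)))\<^sup>2 / 2) \<longlonglongrightarrow> t"
    unfolding t_def by (intro tendsto_intros \<open>(\<lambda>i. h (q i)) \<longlonglongrightarrow> m\<close> z) simp
  then have "(\<lambda>i. snd (q i)) \<longlonglongrightarrow> t"
    by (simp add: h_def)
  with z have "(\<lambda>i. (fst (q i), snd (q i))) \<longlonglongrightarrow> (z, t)"
    by (rule tendsto_Pair)
  with \<open>closed C\<close> q(1) have "(z, t) \<in> C"
    by (auto simp: closed_sequential_limits)
  moreover have "t + (norm z)\<^sup>2 / 2 \<le> s + (norm w)\<^sup>2 / 2" if "(w, s) \<in> C" for w s
    using m_le[OF that] by (simp add: t_def h_def)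
  ultimately show ?thesis
    by (rule that)
qed

text \<open>Move a fraction \<open>r\<close> of the way from \<open>(z, t)\<close> to
  \<open>(w, s)\<close>: the quadratic term is of order r^2, so it vanishes in the limit after
  division by \<open>r\<close>.\<close>

lemma strongly_convex_optimality:
  fixes C :: "('b::real_inner \<times> real) set"
  assumes "convex C" and "(z, t) \<in> C" and "(w, s) \<in> C"
    and min: "\<And>w s. (w, s) \<in> C \<Longrightarrow> t + (norm z)\<^sup>2 / 2 \<le> s + (norm w)\<^sup>2 / 2"
  shows "t \<le> s + inner z (w - z)"
proof (rule field_le_epsilon)
  fix e :: real
  assume "0 < e"
  define K where "K = (norm (w - z))\<^sup>2 / 2"
  \<comment> \<open>Chosen so that the remainder \<open>r * K\<close> is at most \<open>e\<close>;
    the denominator \<open>K + 1\<close> stays positive even when \<open>w = z\<close>.\<close>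
  define r where "r = min 1 (e / (K + 1))"
  have "0 \<le> K"
    by (simp add: K_def)
  with \<open>0 < e\<close> have r: "0 < r" "r \<le> 1"
    by (auto simp: r_def)
  have "r * (K + 1) \<le> e"
    using \<open>0 \<le> K\<close> by (subst pos_le_divide_eq[symmetric]) (auto simp: r_def)
  with r have "r * K \<le> e"
    by (simp add: algebra_simps)
  have "(1 - r) *\<^sub>R (z, t) + r *\<^sub>R (w, s) \<in> C"
    using assms r by (intro convexD) auto
  then have "t + (norm z)\<^sup>2 / 2 \<le> (1 - r) * t + r * s + (norm ((1 - r) *\<^sub>R z + r *\<^sub>R w))\<^sup>2 / 2"
    using min by simp
  also have "\<dots> = t + (norm z)\<^sup>2 / 2 + r * (s - t + inner z (w - z) + r * K)"
    unfolding K_def power2_norm_eq_inner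
    by (simp add: inner_commute algebra_simps) (simp add: field_simps)
  finally have "0 \<le> r * (s - t + inner z (w - z) + r * K)"
    by simp
  with r have "0 \<le> s - t + inner z (w - z) + r * K"
    by (simp add: zero_le_mult_iff)
  with \<open>r * K \<le> e\<close> show "t \<le> s + inner z (w - z) + e"
    by linarith
qed

text \<open>This says that 0 is a value of I + A for the operator A with graph \<open>G\<close>;
  other targets and other parameters \<open>l\<close> reduce to it by an affine change of the
  graph.\<close>

theorem minty_graph:
  fixes G :: "('a::{real_inner, complete_space} \<times> 'a) set"
  assumes "G \<noteq> {}"
    and mono: "\<And>a b c d. (a, b) \<in> G \<Longrightarrow> (c, d) \<in> G \<Longrightarrow> 0 \<le> inner (a - c) (b - d)"
    and maximal: "\<And>x u. (\<And>a b. (a, b) \<in> G \<Longrightarrow> 0 \<le> inner (a - x) (b - u)) \<Longrightarrow> (x, u) \<in> G"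
  shows "\<exists>x. (x, - x) \<in> G"
proof -
  \<comment> \<open>The epigraph of the Fitzpatrick function, which may take the value infinity.\<close>
  define C :: "(('a \<times> 'a) \<times> real) set" where
    "C = (\<Inter>(a, b)\<in>G. {q. inner ((b, a), - 1) q \<le> inner a b})"
  have C_iff: "((x, u), t) \<in> C \<longleftrightarrow> (\<forall>(a, b)\<in>G. inner x b + inner a u - inner a b \<le> t)" for x u t
    by (auto simp: C_def inner_commute algebra_simps)
  have "closed C" "convex C"
    unfolding C_def by (auto intro!: closed_INT convex_INT closed_halfspace_le convex_halfspace_le)
  have graph_C: "((a, b), inner a b) \<in> C" if "(a, b) \<in> G" for a b
    using mono[OF that] by (force simp: C_iff inner_commute algebra_simps)
  \<comment> \<open>The Fitzpatrick function dominates the pairing: if \<open>t\<close> were below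
    it, \<open>(x, u)\<close> would be monotonically related to \<open>G\<close>, hence in
    \<open>G\<close>, and its own constraint would give \<open>inner x u\<close> \<le>
    \<open>t\<close>.\<close>
  have C_lower: "inner x u \<le> t" if "((x, u), t) \<in> C" for x u t
  proof (rule ccontr)
    assume "\<not> inner x u \<le> t"
    with that have "0 \<le> inner (a - x) (b - u)" if "(a, b) \<in> G" for a b
      using that by (fastforce simp: C_iff inner_commute algebra_simps)
    then have "(x, u) \<in> G"
      by (rule maximal)
    with \<open>((x, u), t) \<in> C\<close> \<open>\<not> inner x u \<le> t\<close> show False
      by (force simp: C_iff)
  qed
  have "C \<noteq> {}"
    using \<open>G \<noteq> {}\<close> graph_C by force
  have nonneg: "0 \<le> t + (norm z)\<^sup>2 / 2" if "(z, t) \<in> C" for z t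
  proof -
    obtain x u where [simp]: "z = (x, u)"
      by fastforce
    have "0 \<le> inner (x + u) (x + u)"
      by simp
    then have "0 \<le> (norm z)\<^sup>2 + 2 * inner x u"
      unfolding power2_norm_eq_inner by (simp add: inner_commute algebra_simps)
    with C_lower[of x u t] that show ?thesis
      by simp
  qed
  obtain z t where zt: "(z, t) \<in> C"
    "\<And>w s. (w, s) \<in> C \<Longrightarrow> t + (norm z)\<^sup>2 / 2 \<le> s + (norm w)\<^sup>2 / 2"
    using strongly_convex_minimiser[OF \<open>closed C\<close> \<open>convex C\<close> \<open>C \<noteq> {}\<close> nonneg] by blast
  obtain x u where z: "z = (x, u)"
    by fastforce
  have "inner x u \<le> t"
    using zt z C_lower by blast
  \<comment> \<open>Optimality is tested at a graph point, with value \<open>inner a b\<close>.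
    Bounding \<open>t\<close> below by \<open>inner x u\<close> and adding \<open>inner x u\<close>
    to both sides completes the square.\<close>
  have key: "inner (x + u) (x + u) \<le> inner (a + u) (b + x)" if "(a, b) \<in> G" for a b
    using strongly_convex_optimality[OF \<open>convex C\<close> zt(1) graph_C[OF that] zt(2)] \<open>inner x u \<le> t\<close>
    by (simp add: z inner_commute algebra_simps)
  then have "(- u, - x) \<in> G"
    by (intro maximal) (auto intro: order_trans[OF inner_ge_zero])
  \<comment> \<open>At \<open>(- u, - x)\<close> the right-hand side of \<open>key\<close> vanishes,
    which forces \<open>u = - x\<close>.\<close>
  with key[OF this] have "inner (x + u) (x + u) \<le> 0"
    by simp
  then have "inner (x + u) (x + u) = 0"
    by (intro antisym) auto
  then have "x + u = 0"
    by simp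
  with \<open>(- u, - x) \<in> G\<close> have "(x, - x) \<in> G"
    by (simp add: add_eq_0_iff2)
  then show ?thesis ..
qed

section \<open>Resolvents of maximal monotone operators\<close>

lemma maximal_monotone_mem:
  assumes "maximal_monotone A"
    and rel: "\<And>a b. b \<in> A a \<Longrightarrow> 0 \<le> inner (a - x) (b - u)"
  shows "u \<in> A x"
proof (rule ccontr)
  assume "u \<notin> A x"
  \<comment> \<open>Adjoining the pair \<open>(x, u)\<close> keeps the graph monotone, so its
    absence would contradict maximality.\<close>
  define B where "B = A(x := insert u (A x))"
  have sym: "inner (x - a) (u - b) = inner (a - x) (b - u)" for a b
    by (simp add: algebra_simps)
  have "monotone_operator B"
    using assms unfolding maximal_monotone_def monotone_operator_def B_def by (auto simp: sym)
  moreover have "operator_graph A \<subset> operator_graph B"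
    using \<open>u \<notin> A x\<close> by (auto simp: operator_graph_def B_def)
  ultimately show False
    using assms(1) by (auto simp: maximal_monotone_def)
qed

lemma resolvent_exists:
  fixes A :: "'a::{real_inner, complete_space} \<Rightarrow> 'a set"
  assumes "maximal_monotone A" and "0 < l" and "f0 \<in> A x0"
  shows "\<exists>z. \<exists>f\<in>A z. w = z + l *\<^sub>R f"
proof -
  \<comment> \<open>Scaling the values by \<open>l\<close> and translating them by
    \<open>- w\<close> preserves maximal monotonicity; a point \<open>(x, - x)\<close> of this graph
    is exactly a solution of \<open>w = x + l *\<^sub>R f\<close>.\<close>
  define G where "G = {(a, l *\<^sub>R f - w) |a f. f \<in> A a}"
  have mono: "0 \<le> inner (a - c) (f - g)" if "f \<in> A a" "g \<in> A c" for a c f g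
    using assms(1) that unfolding maximal_monotone_def monotone_operator_def by blast
  have "\<exists>x. (x, - x) \<in> G"
  proof (rule minty_graph)
    show "G \<noteq> {}"
      using assms(3) by (auto simp: G_def)
  next
    fix a b c d
    assume "(a, b) \<in> G" "(c, d) \<in> G"
    then obtain f g where fg: "f \<in> A a" "b = l *\<^sub>R f - w" "g \<in> A c" "d = l *\<^sub>R g - w"
      by (auto simp: G_def)
    then have "b - d = l *\<^sub>R (f - g)"
      by (simp add: scaleR_diff_right)
    then show "0 \<le> inner (a - c) (b - d)"
      using mono[OF fg(1,3)] \<open>0 < l\<close> by simp
  next
    fix x u
    assume rel: "\<And>a b. (a, b) \<in> G \<Longrightarrow> 0 \<le> inner (a - x) (b - u)"
    have "(1 / l) *\<^sub>R (u + w) \<in> A x"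
    proof (rule maximal_monotone_mem[OF assms(1)])
      fix a f
      assume "f \<in> A a"
      then have "0 \<le> inner (a - x) (l *\<^sub>R f - w - u)"
        by (intro rel) (auto simp: G_def)
      also have "l *\<^sub>R f - w - u = l *\<^sub>R (f - (1 / l) *\<^sub>R (u + w))"
        using \<open>0 < l\<close> by (simp add: algebra_simps)
      finally show "0 \<le> inner (a - x) (f - (1 / l) *\<^sub>R (u + w))"
        using \<open>0 < l\<close> by (simp add: zero_le_mult_iff)
    qed
    then show "(x, u) \<in> G"
      using \<open>0 < l\<close> by (force simp: G_def)
  qed
  then obtain x f where "f \<in> A x" "- x = l *\<^sub>R f - w"
    by (auto simp: G_def)
  then have "w = x + l *\<^sub>R f"
    by (simp add: algebra_simps)
  with \<open>f \<in> A x\<close> show ?thesis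
    by blast
qed

text \<open>The equation makes \<open>z - z'\<close> a negative multiple of \<open>f - g\<close>,
  whereas monotonicity makes their inner product nonnegative.\<close>

lemma resolvent_point_unique:
  assumes "monotone_operator A" and "0 < l"
    and "f \<in> A z" "g \<in> A z'" and eq: "z + l *\<^sub>R f = z' + l *\<^sub>R g"
  shows "z = z'"
proof -
  have "z - z' = - (l *\<^sub>R (f - g))"
    using eq by (simp add: algebra_simps)
  then have "inner (z - z') (z - z') = - (l * inner (z - z') (f - g))"
    by (metis inner_minus_right inner_scaleR_right)
  moreover have "0 \<le> l * inner (z - z') (f - g)"
    using assms unfolding monotone_operator_def by (intro mult_nonneg_nonneg) auto
  ultimately have "inner (z - z') (z - z') \<le> 0"
    by linarith
  then have "inner (z - z') (z - z') = 0"
    by (intro antisym) auto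
  then show ?thesis
    by simp
qed

lemma resolvent_spec:
  fixes A :: "'a::{real_inner, complete_space} \<Rightarrow> 'a set"
  assumes "maximal_monotone A" and "0 < l" and "f0 \<in> A x0"
  shows "\<exists>f\<in>A (resolvent l A w). w = resolvent l A w + l *\<^sub>R f"
proof -
  have "\<exists>!z. \<exists>f\<in>A z. w = z + l *\<^sub>R f"
    using resolvent_exists[OF assms, of w] resolvent_point_unique[of A l] assms(1,2)
    unfolding maximal_monotone_def by metis
  then show ?thesis
    unfolding resolvent_def by (rule theI')
qed

text \<open>For the resolvent value z, w - z is \<open>l\<close> times an element of A z. Since 0
  lies in \<open>A p\<close>, monotonicity makes the cross term nonnegative when w - p is split as
  (z - p) + (w - z).\<close>

lemma resolvent_firmly_nonexpansive:
  fixes A :: "'a::{real_inner, complete_space} \<Rightarrow> 'a set"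
  assumes "maximal_monotone A" and "0 < l" and "p \<in> operator_zeros A"
  shows "(norm (resolvent l A w - p))\<^sup>2 \<le> (norm (w - p))\<^sup>2 - (norm (resolvent l A w - w))\<^sup>2"
proof -
  have "0 \<in> A p"
    using assms(3) by (simp add: operator_zeros_def)
  define z where "z = resolvent l A w"
  obtain f where f: "f \<in> A z" "w = z + l *\<^sub>R f"
    using resolvent_spec[OF assms(1,2) \<open>0 \<in> A p\<close>] unfolding z_def by blast
  have "0 \<le> inner (z - p) (f - 0)"
    using assms(1) f(1) \<open>0 \<in> A p\<close> unfolding maximal_monotone_def monotone_operator_def by blast
  then have "0 \<le> l * inner (z - p) f"
    using \<open>0 < l\<close> by simp
  moreover have "(norm (w - p))\<^sup>2 - (norm (z - w))\<^sup>2 - (norm (z - p))\<^sup>2 = 2 * (l * inner (z - p) f)"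
    unfolding f(2) power2_norm_eq_inner by (simp add: inner_commute algebra_simps)
  ultimately show ?thesis
    by (simp add: z_def)
qed

section \<open>The inertial iteration\<close>

lemma inertial_step_identity:
  fixes x3 x2 x1 x0 p :: "'a::real_inner"
    and \<theta> \<delta> :: real
  defines "w \<equiv> x2 + \<theta> *\<^sub>R (x2 - x1) + \<delta> *\<^sub>R (x1 - x0)"
  shows "(norm (w - p))\<^sup>2 - (norm (x3 - w))\<^sup>2 =
    (1 + \<theta>) * (norm (x2 - p))\<^sup>2 - (\<theta> - \<delta>) * (norm (x1 - p))\<^sup>2 - \<delta> * (norm (x0 - p))\<^sup>2
    - (1 - \<theta> + \<delta>) * (norm (x3 - x2))\<^sup>2 + (2 * \<theta> - \<delta>) * (norm (x2 - x1))\<^sup>2 - \<delta> * (norm (x1 - x0))\<^sup>2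
    - \<theta> * (norm ((x3 - x2) - (x2 - x1)))\<^sup>2
    + \<delta> * (norm ((x3 - x2) + (x1 - x0)))\<^sup>2 + \<delta> * (norm ((x2 - x1) + (x1 - x0)))\<^sup>2"
proof -
  define a b c v where "a = x3 - x2" and "b = x2 - x1" and "c = x1 - x0" and "v = x0 - p"
  have e: "x1 - p = c + v" "x2 - p = b + c + v" "w - p = b + c + v + \<theta> *\<^sub>R b + \<delta> *\<^sub>R c"
    "x3 - w = a - \<theta> *\<^sub>R b - \<delta> *\<^sub>R c"
    unfolding a_def b_def c_def v_def w_def by (simp_all add: algebra_simps)
  show ?thesis
    unfolding e a_def[symmetric] b_def[symmetric] c_def[symmetric] v_def[symmetric] power2_norm_eq_inner
    by (simp add: inner_commute algebra_simps)
qed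

lemma norm_sum_squared_le:
  fixes u v :: "'a::real_inner"
  shows "(norm (u + v))\<^sup>2 \<le> 2 * (norm u)\<^sup>2 + 2 * (norm v)\<^sup>2"
proof -
  have "0 \<le> inner (u - v) (u - v)"
    by simp
  then show ?thesis
    unfolding power2_norm_eq_inner by (simp add: inner_commute algebra_simps)
qed

lemma norm_sum3_squared_le:
  fixes u v w :: "'a::real_inner"
  shows "(norm (u + v + w))\<^sup>2 \<le> 3 * ((norm u)\<^sup>2 + (norm v)\<^sup>2 + (norm w)\<^sup>2)"
proof -
  have "0 \<le> inner (u - v) (u - v)" "0 \<le> inner (v - w) (v - w)" "0 \<le> inner (u - w) (u - w)"
    by simp_all
  then show ?thesis
    unfolding power2_norm_eq_inner by (simp add: inner_commute algebra_simps)
qed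

lemma inertial_energy_bound:
  fixes x y :: "int \<Rightarrow> 'a::real_inner"
  assumes \<theta>: "0 \<le> \<theta>" "\<theta> \<le> 1/2" and \<delta>: "\<delta> \<le> 0"
    and start: "x 0 = x (-1)" "x (-1) = x (-2)"
    and y: "\<And>k. 0 \<le> k \<Longrightarrow> y k = x k + \<theta> *\<^sub>R (x k - x (k - 1)) + \<delta> *\<^sub>R (x (k - 1) - x (k - 2))"
    and firm: "\<And>k. 0 \<le> k \<Longrightarrow>
      (norm (x (k + 1) - p))\<^sup>2 \<le> (norm (y k - p))\<^sup>2 - (norm (x (k + 1) - y k))\<^sup>2"
  shows "(1 - 3 * \<theta> + 3 * \<delta>) * (\<Sum>k<N. (norm (x (int k + 1) - x (int k)))\<^sup>2)
    \<le> (1 - \<theta> - \<delta>) * (norm (x 0 - p))\<^sup>2"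
proof -
  define X where "X k = (norm (x k - p))\<^sup>2" for k
  define D where "D k = (norm (x (k + 1) - x k))\<^sup>2" for k
  have nonneg: "0 \<le> X k" "0 \<le> D k" for k
    by (simp_all add: X_def D_def)
  have step: "X (k + 1) \<le> (1 + \<theta>) * X k - (\<theta> - \<delta>) * X (k - 1) - \<delta> * X (k - 2)
      - (1 - \<theta> + \<delta>) * D k + (2 * \<theta> - \<delta>) * D (k - 1) - \<delta> * D (k - 2)" if "0 \<le> k" for k
  proof -
    have "0 \<le> \<theta> * (norm ((x (k + 1) - x k) - (x k - x (k - 1))))\<^sup>2"
      "\<delta> * (norm ((x (k + 1) - x k) + (x (k - 1) - x (k - 2))))\<^sup>2 \<le> 0"
      "\<delta> * (norm ((x k - x (k - 1)) + (x (k - 1) - x (k - 2))))\<^sup>2 \<le> 0"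
      using \<theta> \<delta> by (auto simp: mult_nonpos_nonneg)
    then show ?thesis
      using firm[OF that] inertial_step_identity[of "x k" \<theta> "x (k - 1)" \<delta> "x (k - 2)" p "x (k + 1)"]
      unfolding y[OF that] X_def D_def by simp
  qed
  \<comment> \<open>The weights on \<open>D\<close> carry the delayed terms of \<open>step\<close>
    forward, so each \<open>D k\<close> is charged once with total coefficient -(1 - \<theta> +
    \<delta>) + (2\<theta> - \<delta>) - \<delta>. Equal starting points give the initial energy (1
    - \<theta> - \<delta>) \<open>X 0\<close>.\<close>
  have energy: "X (int N) - \<theta> * X (int N - 1) - \<delta> * X (int N - 2)
      + (2 * \<theta> - 2 * \<delta>) * D (int N - 1) - \<delta> * D (int N - 2)
      + (1 - 3 * \<theta> + 3 * \<delta>) * (\<Sum>k<N. D (int k)) \<le> (1 - \<theta> - \<delta>) * X 0"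
  proof (induction N)
    case 0
    have "D (-1) = 0" "D (-2) = 0" "X (-1) = X 0" "X (-2) = X 0"
      using start by (simp_all add: D_def X_def)
    then show ?case
      by (simp add: algebra_simps)
  next
    case (Suc N)
    have *: "int (Suc N) = int N + 1" "int N + 1 - 1 = int N" "int N + 1 - 2 = int N - 1"
      by simp_all
    show ?case
      using Suc.IH step[of "int N"] unfolding * sum.lessThan_Suc by (simp add: algebra_simps)
  qed
  \<comment> \<open>It remains to see that the final energy is nonnegative. The only negative term,
    -\<theta> \<open>X (int N - 1)\<close>, is absorbed by \<open>X (int N)\<close>, using 2\<theta>
    \<le> 1, and by the \<theta>-part of the weight on \<open>D (int N - 1)\<close>.\<close>
  have "X (int N - 1) \<le> 2 * X (int N) + 2 * D (int N - 1)"
    using norm_sum_squared_le[of "x (int N) - p" "x (int N - 1) - x (int N)"]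
    by (simp add: X_def D_def norm_minus_commute)
  then have "\<theta> * X (int N - 1) \<le> \<theta> * (2 * X (int N) + 2 * D (int N - 1))"
    using \<theta> by (intro mult_left_mono)
  moreover have "2 * \<theta> * X (int N) \<le> 1 * X (int N)"
    using \<theta> nonneg by (intro mult_right_mono) auto
  moreover have "\<delta> * X (int N - 2) \<le> 0" "\<delta> * D (int N - 1) \<le> 0" "\<delta> * D (int N - 2) \<le> 0"
    using \<delta> nonneg by (auto simp: mult_nonpos_nonneg)
  ultimately show ?thesis
    using energy unfolding D_def[symmetric] X_def[symmetric] by (simp add: algebra_simps)
qed

section \<open>From summable steps to the residual rate\<close>

lemma sum_int_shift_le:
  fixes D :: "int \<Rightarrow> real"
  assumes "\<And>k. 0 \<le> D k" and "\<And>k. - int m \<le> k \<Longrightarrow> k < 0 \<Longrightarrow> D k = 0"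
  shows "(\<Sum>k<N. D (int k - int m)) \<le> (\<Sum>k<N. D (int k))"
proof -
  have "(\<Sum>k<N. D (int k - int m)) = (\<Sum>k\<in>{m..<N}. D (int k - int m))"
    using assms(2) by (intro sum.mono_neutral_right) (auto simp: not_le)
  \<comment> \<open>For \<open>N < m\<close> the subtraction truncates to 0 and both sums are
    empty.\<close>
  also have "\<dots> = (\<Sum>k<N - m. D (int k))"
    by (rule sum.reindex_bij_witness[of _ "\<lambda>k. k + m" "\<lambda>k. k - m"]) (auto simp: of_nat_diff)
  also have "\<dots> \<le> (\<Sum>k<N. D (int k))"
    using assms(1) by (intro sum_mono2) auto
  finally show ?thesis .
qed

theorem theorem3p4:
  fixes A :: "'a::{real_inner, complete_space} \<Rightarrow> 'a set"
    and l \<theta> \<delta> c2 :: real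
    and x y :: "int \<Rightarrow> 'a"
    and xs :: 'a
    and n :: int
  assumes "maximal_monotone A"
    and "operator_zeros A \<noteq> {}"
    and "l > 0"
    and "0 \<le> \<theta>" and "\<theta> < 1/3"
    and "(3 * \<theta> - 1) / (3 + 4 * \<theta>) < \<delta>" and "\<delta> \<le> 0"
    and "x 0 = x (-1)" and "x (-1) = x (-2)"
    and "y 0 = x 0 + \<theta> *\<^sub>R (x 0 - x (-1)) + \<delta> *\<^sub>R (x (-1) - x (-2))"
    and "\<forall>k\<ge>0. x (k + 1) = resolvent l A (y k)"
    and "\<forall>k\<ge>0. y (k + 1) = x (k + 1) + \<theta> *\<^sub>R (x (k + 1) - x k) + \<delta> *\<^sub>R (x k - x (k - 1))"
    and "c2 = 1 - 3 * \<theta> - 2 * \<bar>\<delta>\<bar> - 2 * \<theta> * \<bar>\<delta>\<bar> + 2 * \<theta> * \<delta> + \<delta>"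
    and "xs \<in> operator_zeros A"
    and "n \<ge> 2"
  shows "Min ((\<lambda>j. (norm (x (j + 1) - y j))\<^sup>2) ` {0..n - 2})
    \<le> 3 * (1 + \<theta>\<^sup>2 + \<delta>\<^sup>2) * (1 / c2) * ((1 - \<theta> - \<delta>) * (norm (x 0 - xs))\<^sup>2 / (real_of_int n - 1))"
proof -
  define D where "D = (\<lambda>k. (norm (x (k + 1) - x k))\<^sup>2)"
  define R where "R = (\<lambda>j. (norm (x (j + 1) - y j))\<^sup>2)"
  define N where "N = nat (n - 1)"
  define S where "S = (\<Sum>k<N. D (int k))"
  define M where "M = Min (R ` {0..n - 2})"
  have N: "real N = real_of_int n - 1" "0 < real N"
    using \<open>n \<ge> 2\<close> by (auto simp: N_def)
  \<comment> \<open>The sign of \<delta> resolves the absolute values; the lower bound on \<delta>,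
    cleared of its positive denominator, then says \<open>0 < c2\<close>.\<close>
  have c2: "c2 = 1 - 3 * \<theta> + 3 * \<delta> + 4 * \<theta> * \<delta>"
    using assms(7,13) by (simp add: algebra_simps)
  have "0 < c2"
    using assms(4,6) unfolding c2 by (simp add: divide_less_eq algebra_simps)
  \<comment> \<open>At \<open>k = 0\<close> the formula is the assumed value of \<open>y 0\<close>;
    for larger \<open>k\<close> it is the recursion shifted by one.\<close>
  have y: "y k = x k + \<theta> *\<^sub>R (x k - x (k - 1)) + \<delta> *\<^sub>R (x (k - 1) - x (k - 2))" if "0 \<le> k" for k
  proof (cases "k = 0")
    case True
    then show ?thesis
      using assms(10) by simp
  next
    case False
    then show ?thesis
      using assms(12)[rule_format, of "k - 1"] that by (simp add: algebra_simps)
  qed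
  have "(1 - 3 * \<theta> + 3 * \<delta>) * S \<le> (1 - \<theta> - \<delta>) * (norm (x 0 - xs))\<^sup>2"
    unfolding S_def D_def
  proof (rule inertial_energy_bound)
    fix k :: int
    assume "0 \<le> k"
    then show "(norm (x (k + 1) - xs))\<^sup>2 \<le> (norm (y k - xs))\<^sup>2 - (norm (x (k + 1) - y k))\<^sup>2"
      using assms(11) resolvent_firmly_nonexpansive[OF assms(1,3,14), of "y k"] by simp
  qed (use assms y in auto)
  moreover have "0 \<le> S"
    by (simp add: S_def D_def sum_nonneg)
  \<comment> \<open>The energy coefficient exceeds \<open>c2\<close> by -4\<theta>\<delta> \<ge> 0,
    so passing to \<open>c2\<close> only weakens the bound.\<close>
  then have "c2 * S \<le> (1 - 3 * \<theta> + 3 * \<delta>) * S"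
    using assms(4,7) unfolding c2 by (intro mult_right_mono) (auto simp: mult_nonneg_nonpos)
  ultimately have S_le: "S \<le> (1 - \<theta> - \<delta>) * (norm (x 0 - xs))\<^sup>2 / c2"
    using \<open>0 < c2\<close> by (simp add: le_divide_eq mult.commute)
  \<comment> \<open>The residual is the current step minus multiples of the two preceding ones; the
    three summands produce the factor 3.\<close>
  have R_le: "R k \<le> 3 * (D k + \<theta>\<^sup>2 * D (k - 1) + \<delta>\<^sup>2 * D (k - 2))" if "0 \<le> k" for k
    using norm_sum3_squared_le[of "x (k + 1) - x k" "- (\<theta> *\<^sub>R (x k - x (k - 1)))" "- (\<delta> *\<^sub>R (x (k - 1) - x (k - 2)))"]
    unfolding R_def D_def y[OF that]
    by (simp add: power_mult_distrib diff_diff_eq)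
  have "D (-1) = 0" "D (-2) = 0"
    using assms(8,9) by (simp_all add: D_def)
  then have D_zero: "D k = 0" if "- 2 \<le> k" "k < 0" for k
    using that by (cases "k = -1") (auto dest: antisym)
  \<comment> \<open>The delayed sums begin at indices -1 and -2, where the steps vanish.\<close>
  have shift: "(\<Sum>k<N. D (int k - 1)) \<le> S" "(\<Sum>k<N. D (int k - 2)) \<le> S"
    using sum_int_shift_le[of D 1 N] sum_int_shift_le[of D 2 N] D_zero by (simp_all add: S_def D_def)
  \<comment> \<open>The indices 0, ..., n - 2 number exactly \<open>N\<close>, so \<open>M\<close>
    is at most the average of \<open>N\<close> residuals.\<close>
  have "real N * M = (\<Sum>k<N. M)"
    by simp
  also have "\<dots> \<le> (\<Sum>k<N. R (int k))"
    by (intro sum_mono) (auto simp: M_def N_def intro!: Min_le)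
  also have "\<dots> \<le> (\<Sum>k<N. 3 * (D (int k) + \<theta>\<^sup>2 * D (int k - 1) + \<delta>\<^sup>2 * D (int k - 2)))"
    by (intro sum_mono R_le) simp
  also have "\<dots> = 3 * (S + \<theta>\<^sup>2 * (\<Sum>k<N. D (int k - 1)) + \<delta>\<^sup>2 * (\<Sum>k<N. D (int k - 2)))"
    by (simp add: S_def sum.distrib sum_distrib_left)
  also have "\<dots> \<le> 3 * (S + \<theta>\<^sup>2 * S + \<delta>\<^sup>2 * S)"
    using shift by (intro mult_left_mono add_mono) auto
  also have "\<dots> = 3 * (1 + \<theta>\<^sup>2 + \<delta>\<^sup>2) * S"
    by (simp add: algebra_simps)
  also have "\<dots> \<le> 3 * (1 + \<theta>\<^sup>2 + \<delta>\<^sup>2) * ((1 - \<theta> - \<delta>) * (norm (x 0 - xs))\<^sup>2 / c2)"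
    using S_le by (intro mult_left_mono) auto
  finally have "M \<le> 3 * (1 + \<theta>\<^sup>2 + \<delta>\<^sup>2) * ((1 - \<theta> - \<delta>) * (norm (x 0 - xs))\<^sup>2 / c2) / real N"
    using N(2) by (subst pos_le_divide_eq) (simp_all only: mult.commute)
  then show ?thesis
    unfolding M_def R_def N(1) by simp
qed

end
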